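(* Let $m$ and $n$ be positive integers with $n$ odd. Then $$\epsilon_{mn+(n-1)/2}\ \ge\ 2\,|\mathcal{S}_n|^m\,\epsilon_m.$$
   Context: For integers $a\le b$, $[a,b]=\{a,\ldots,b\}$. An extended Skolem sequence of order $M$ is a sequence $(s_1,\ldots,s_{2M+1})$ of $2M+1$ integers such that exactly one entry equals $0$, the $0$ is neither in the first nor in the last position, and for every $k\in[1,M]$ there are exactly two subscripts $i,j$ with $s_i=s_j=k$, and these satisfy $|i-j|=k$. $\epsilon_M$ denotes the number of extended Skolem sequences of order $M$. $\mathcal{S}_n$ denotes the set of all digraphs $S$ with vertex set $[1,n]$ (loops allowed) such that every vertex has exactly one outgoing arc and exactly one incoming arc (a loop counts as both), and such that the $n$ numbers $i+j$, for $(i,j)\in E(S)$ (a loop at $i$ giving $2i$), are pairwise distinct and form a set of $n$ consecutive integers.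
   Formalization: The case n = 1 is excluded: there |S_1| = 1 and the claim would read ε_m ≥ 2ε_m, which is false, e.g. for m = 2, since (1,1,2,0,2) shows ε_2 > 0. *)

theory Defs
  imports "Graph_Theory.Graph_Theory"
begin

text \<open>The entry \<open>s\<^sub>i\<close> is \<open>s ! (i - 1)\<close>; only differences of positions matter.\<close>

definition ext_skolem :: "nat \<Rightarrow> int list \<Rightarrow> bool" where
  "ext_skolem M s \<longleftrightarrow>
     length s = 2 * M + 1 \<and>
     (\<exists>!i. i < length s \<and> s ! i = 0) \<and>
     s ! 0 \<noteq> 0 \<and> s ! (length s - 1) \<noteq> 0 \<and>
     (\<forall>k \<in> {1..int M}. \<exists>i j. i \<noteq> j \<and> {l. l < length s \<and> s ! l = k} = {i, j} \<and>
        \<bar>int i - int j\<bar> = k)"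

definition eps :: "nat \<Rightarrow> nat" where
  "eps M = card {s. ext_skolem M s}"

text \<open>A digraph on \<open>{1..n}\<close> has no parallel arcs, so its arcs are pairs of vertices. The loop
  \<open>(i, i)\<close> is both an out-arc and an in-arc of \<open>i\<close>. As all vertices are positive, the least of the
  \<open>n\<close> consecutive integers can be taken to be a natural number.\<close>

definition sum_digraphs :: "nat \<Rightarrow> nat pair_pre_digraph set" where
  "sum_digraphs n = {S. pair_wf_digraph S \<and> pverts S = {1..n} \<and>
     (\<forall>v \<in> pverts S. out_degree (with_proj S) v = 1 \<and> in_degree (with_proj S) v = 1) \<and>
     inj_on (\<lambda>(i, j). i + j) (parcs S) \<and>
     (\<exists>a. (\<lambda>(i, j). i + j) ` parcs S = {a..<a + n})}"

text \<open>All sets counted above are finite, so no cardinality is the default value \<open>0\<close>.\<close>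

lemma ext_skolem_length: "ext_skolem M s \<Longrightarrow> length s = 2 * M + 1"
  unfolding ext_skolem_def by (elim conjE)

lemma ext_skolem_entries:
  assumes "ext_skolem M s"
  shows "set s \<subseteq> {0..int M}"
proof -
  define A where "A k = {l. l < length s \<and> s ! l = k}" for k
  have len: "length s = 2 * M + 1" using assms by (rule ext_skolem_length)
  have fin: "finite (A k)" for k by (simp add: A_def)
  have disj: "A k \<inter> A l = {}" if "k \<noteq> l" for k l using that by (auto simp: A_def)
  have c0: "card (A 0) = 1"
  proof -
    have "\<exists>!i. i < length s \<and> s ! i = 0"
      using assms unfolding ext_skolem_def by (elim conjE)
    then obtain i where "i < length s \<and> s ! i = 0" "\<And>j. j < length s \<and> s ! j = 0 \<Longrightarrow> j = i"
      by (elim ex1E) blast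
    then have "A 0 = {i}" unfolding A_def by blast
    then show ?thesis by simp
  qed
  have ck: "card (A k) = 2" if "k \<in> {1..int M}" for k
  proof -
    have "\<forall>k \<in> {1..int M}. \<exists>i j. i \<noteq> j \<and> A k = {i, j} \<and> \<bar>int i - int j\<bar> = k"
      using assms unfolding ext_skolem_def A_def by (elim conjE)
    from bspec[OF this that] obtain i j where "i \<noteq> j" "A k = {i, j}" by (elim exE conjE)
    then show ?thesis by simp
  qed
  have "card (\<Union>k\<in>{1..int M}. A k) = (\<Sum>k\<in>{1..int M}. card (A k))"
    using fin disj by (intro card_UN_disjoint) simp_all
  also have "\<dots> = 2 * M" using ck by simp
  finally have U: "card (\<Union>k\<in>{1..int M}. A k) = 2 * M" .
  have "A 0 \<inter> (\<Union>k\<in>{1..int M}. A k) = {}" by (auto simp: A_def)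
  then have "card (A 0 \<union> (\<Union>k\<in>{1..int M}. A k)) = card {..<length s}"
    using fin by (subst card_Un_disjoint) (simp_all add: c0 U len)
  moreover have "A 0 \<union> (\<Union>k\<in>{1..int M}. A k) \<subseteq> {..<length s}" by (auto simp: A_def)
  ultimately have eq: "A 0 \<union> (\<Union>k\<in>{1..int M}. A k) = {..<length s}"
    by (intro card_subset_eq) simp_all
  show ?thesis
  proof
    fix x assume "x \<in> set s"
    then obtain l where l: "l < length s" "x = s ! l" by (metis in_set_conv_nth)
    with eq have "l \<in> A 0 \<union> (\<Union>k\<in>{1..int M}. A k)" by blast
    with l show "x \<in> {0..int M}" by (auto simp: A_def)
  qed
qed

lemma finite_ext_skolem: "finite {s. ext_skolem M s}"
proof (rule finite_subset)
  show "{s. ext_skolem M s} \<subseteq> {s. set s \<subseteq> {0..int M} \<and> length s = 2 * M + 1}"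
    using ext_skolem_entries ext_skolem_length by blast
qed (simp add: finite_lists_length_eq)

lemma finite_sum_digraphs: "finite (sum_digraphs n)"
proof (rule finite_subset)
  show "sum_digraphs n \<subseteq>
    (\<lambda>E. \<lparr>pverts = {1..n}, parcs = E\<rparr>) ` Pow ({1..n} \<times> {1..n})"
  proof
    fix S assume S: "S \<in> sum_digraphs n"
    then interpret pair_wf_digraph S by (simp add: sum_digraphs_def)
    have v: "pverts S = {1..n}" using S by (simp add: sum_digraphs_def)
    have "parcs S \<subseteq> {1..n} \<times> {1..n}"
      using arc_fst_in_verts arc_snd_in_verts v by force
    then show "S \<in> (\<lambda>E. \<lparr>pverts = {1..n}, parcs = E\<rparr>) ` Pow ({1..n} \<times> {1..n})"
      using v by (intro image_eqI[of _ _ "parcs S"]) auto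
  qed
qed simp

text \<open>The inequality \<open>eps (m * n + (n - 1) div 2) \<ge> 2 * card (sum_digraphs n) ^ m * eps m\<close> fails for
  \<open>n = 1\<close>: there is a single digraph, so it reads \<open>eps m \<ge> 2 * eps m\<close>, while, for example,
  \<open>eps 2 > 0\<close> because of the sequence \<open>(1, 1, 2, 0, 2)\<close>. Hence \<open>n = 1\<close> has to be excluded.\<close>

lemma eps_2_pos: "eps 2 > 0"
proof -
  have "ext_skolem 2 [1, 1, 2, 0, 2]"
    unfolding ext_skolem_def
  proof (intro conjI ballI)
    show "\<exists>!i. i < length [1, 1, 2, 0, 2::int] \<and> [1, 1, 2, 0, 2] ! i = (0::int)"
      by (rule ex1I[of _ 3]) (auto simp: less_Suc_eq nth_Cons split: nat.splits)
    fix k assume "k \<in> {1..int 2}"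
    then consider "k = 1" | "k = 2" by force
    then show "\<exists>i j. i \<noteq> j \<and> {l. l < length [1, 1, 2, 0, 2::int] \<and> [1, 1, 2, 0, 2] ! l = k} = {i, j} \<and>
        \<bar>int i - int j\<bar> = k"
    proof cases
      case 1
      then show ?thesis
        by (intro exI[of _ 0] exI[of _ 1]) (auto simp: less_Suc_eq)
    next
      case 2
      then show ?thesis
        by (intro exI[of _ 2] exI[of _ 4]) (auto simp: less_Suc_eq)
    qed
  qed auto
  then show ?thesis
    using finite_ext_skolem[of 2] by (auto simp: eps_def card_gt_0_iff)
qed

lemma card_sum_digraphs_1: "card (sum_digraphs 1) = 1"
proof -
  let ?L = "\<lparr>pverts = {1}, parcs = {(1, 1)}\<rparr> :: nat pair_pre_digraph"
  have "?L \<in> sum_digraphs 1"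
  proof -
    have "{e. e = (1::nat, 1::nat) \<and> fst e = 1} = {(1, 1)}"
      "{e. e = (1::nat, 1::nat) \<and> snd e = 1} = {(1, 1)}" by auto
    then show ?thesis
      by (auto simp: sum_digraphs_def pair_wf_digraph_def out_degree_def in_degree_def
          out_arcs_def in_arcs_def intro!: exI[of _ 2])
  qed
  moreover have "S = ?L" if S: "S \<in> sum_digraphs 1" for S
  proof -
    interpret pair_wf_digraph S using S by (simp add: sum_digraphs_def)
    have v: "pverts S = {1}" using S by (auto simp: sum_digraphs_def)
    have sub: "parcs S \<subseteq> {(1, 1)}" using arc_fst_in_verts arc_snd_in_verts v by force
    have "parcs S \<noteq> {}" using S by (auto simp: sum_digraphs_def)
    with sub have "parcs S = {(1, 1)}" by (metis subset_singletonD)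
    with v show ?thesis by simp
  qed
  ultimately have "sum_digraphs 1 = {?L}" by blast
  then show ?thesis by simp
qed

lemma inequality_fails_for_n_1:
  "\<not> eps (2 * 1 + (1 - 1) div 2) \<ge> 2 * card (sum_digraphs 1) ^ 2 * eps 2"
  using eps_2_pos card_sum_digraphs_1 by simp

end

theory Submission
  imports Defs "HOL-Combinatorics.Permutations"
begin

text \<open>Write \<open>n = 2 * q + 1\<close>. Summing \<open>i + j\<close> over all arcs of a digraph in \<open>sum_digraphs n\<close> gives
  \<open>n * (n + 1)\<close>, so the induced sums are centred at \<open>n + 1\<close>. Sending the arc \<open>(i, j)\<close> to the pair
  \<open>(i, n + 1 - j)\<close> therefore yields a permutation whose displacements are exactly \<open>-q, \<dots>, q\<close>.

  Given an extended Skolem sequence of order \<open>m\<close>, replace each position by a block of \<open>n\<close> positions.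
  The two blocks of the symbol \<open>k\<close> are joined along the permutation of the \<open>k\<close>-th digraph, which
  realises the differences \<open>n * k - q, \<dots>, n * k + q\<close>; the block of \<open>0\<close> receives a sequence that
  realises \<open>1, \<dots>, q\<close> with one hole. Since the block of \<open>0\<close> is interior, that hole may be anywhere in
  the block, so any such sequence and its reversal are both admissible. All choices are read off the
  result, because rounding an entry to the nearest multiple of \<open>n\<close> recovers \<open>n * k\<close>.\<close>

section \<open>Skolem sequences with a hole at an arbitrary position\<close>

text \<open>Only the existence of the pairs and of the hole is asked for; uniqueness follows by
  counting. The hole may lie at an end, which is unavoidable for order 1.\<close>

definition skolem_pairs :: "nat \<Rightarrow> int list \<Rightarrow> bool" where
  "skolem_pairs M s \<longleftrightarrow> length s = 2 * M + 1 \<and> (\<exists>z < length s. s ! z = 0) \<and>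
     (\<forall>k \<in> {1..M}. \<exists>a. a + k < length s \<and> s ! a = int k \<and> s ! (a + k) = int k)"

lemma skolem_pairs_obtain:
  assumes "skolem_pairs M s" "k \<in> {1..M}"
  obtains a where "a + k < length s" "s ! a = int k" "s ! (a + k) = int k"
  using assms unfolding skolem_pairs_def by blast

text \<open>The pairs and the hole already exhaust the \<open>2 * M + 1\<close> positions.\<close>

lemma skolem_pairs_count:
  assumes "skolem_pairs M s"
  shows "k \<le> M \<Longrightarrow> card {l. l < length s \<and> s ! l = int k} = (if k = 0 then 1 else 2)"
    and "l < length s \<Longrightarrow> s ! l \<in> {0..int M}"
proof -
  define A where "A k = {l. l < length s \<and> s ! l = int k}" for k
  define c :: "nat \<Rightarrow> nat" where "c k = (if k = 0 then 1 else 2)" for k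
  have len: "length s = 2 * M + 1" using assms by (simp add: skolem_pairs_def)
  have fin: "finite (A k)" for k by (simp add: A_def)
  have ge: "c k \<le> card (A k)" if "k \<in> {..M}" for k
  proof (cases "k = 0")
    case True
    obtain z where "z < length s" "s ! z = 0" using assms by (auto simp: skolem_pairs_def)
    then have "{z} \<subseteq> A k" by (auto simp: A_def True)
    from card_mono[OF fin this] True show ?thesis by (simp add: c_def)
  next
    case False
    have "k \<in> {1..M}" using False that by auto
    then obtain a where "a + k < length s" "s ! a = int k" "s ! (a + k) = int k"
      using skolem_pairs_obtain[OF assms] by blast
    then have "{a, a + k} \<subseteq> A k" by (auto simp: A_def)
    from card_mono[OF fin this] False show ?thesis by (simp add: c_def)
  qed
  have U: "(\<Sum>k\<le>M. card (A k)) = card (\<Union>k\<le>M. A k)"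
    by (intro card_UN_disjoint[symmetric]) (auto simp: fin A_def)
  have sub: "(\<Union>k\<le>M. A k) \<subseteq> {..<length s}" by (auto simp: A_def)
  then have "card (\<Union>k\<le>M. A k) \<le> card {..<length s}" by (intro card_mono) auto
  moreover have "(\<Sum>k\<le>M. c k) = 2 * M + 1" by (induction M) (auto simp: c_def)
  moreover have "(\<Sum>k\<le>M. c k) \<le> (\<Sum>k\<le>M. card (A k))" by (intro sum_mono ge)
  \<comment> \<open>The lower bounds \<open>c k\<close> already add up to the length, and the
    disjoint classes \<open>A k\<close> cannot hold more. So every bound is attained and the classes
    cover all positions.\<close>
  ultimately have eq: "(\<Sum>k\<le>M. c k) = (\<Sum>k\<le>M. card (A k))"
    and full: "card (\<Union>k\<le>M. A k) = card {..<length s}"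
    using U len by auto
  show "card {l. l < length s \<and> s ! l = int k} = (if k = 0 then 1 else 2)" if "k \<le> M"
    using sum_mono_inv[OF eq ge, of k] that by (simp add: A_def c_def)
  have "(\<Union>k\<le>M. A k) = {..<length s}" using sub full by (intro card_subset_eq) auto
  then have "l \<in> (\<Union>k\<le>M. A k)" if "l < length s" using that by simp
  then show "s ! l \<in> {0..int M}" if "l < length s" using that by (auto simp: A_def)
qed

lemma skolem_pairs_zero:
  assumes "skolem_pairs M s"
  obtains z where "{l. l < length s \<and> s ! l = 0} = {z}"
  using skolem_pairs_count(1)[OF assms, of 0] by (auto simp: card_1_singleton_iff)

lemma skolem_pairs_positions:
  assumes "skolem_pairs M s" "k \<in> {1..M}"
  obtains a where "{l. l < length s \<and> s ! l = int k} = {a, a + k}"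
proof -
  obtain a where a: "a + k < length s" "s ! a = int k" "s ! (a + k) = int k"
    using skolem_pairs_obtain[OF assms] .
  have "{a, a + k} = {l. l < length s \<and> s ! l = int k}"
    using a assms(2) skolem_pairs_count(1)[OF assms(1), of k] by (intro card_subset_eq) auto
  with that show thesis by metis
qed

text \<open>Reduces the exact counts in \<open>ext_skolem\<close> to exhibiting one hole and one
  pair per symbol, plus a check of the two ends.\<close>

lemma ext_skolem_iff:
  "ext_skolem M s \<longleftrightarrow> skolem_pairs M s \<and> s ! 0 \<noteq> 0 \<and> s ! (2 * M) \<noteq> 0"
proof
  assume s: "ext_skolem M s"
  have "\<exists>a. a + k < length s \<and> s ! a = int k \<and> s ! (a + k) = int k" if k: "k \<in> {1..M}" for k
  proof -
    have "int k \<in> {1..int M}" using k by auto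
    then obtain i j where ij: "{l. l < length s \<and> s ! l = int k} = {i, j}" "\<bar>int i - int j\<bar> = int k"
      using s unfolding ext_skolem_def by blast
    then have mem: "i < length s" "j < length s" "s ! i = int k" "s ! j = int k" by auto
    from ij(2) have "j = i + k \<or> i = j + k" by linarith
    with mem show ?thesis by auto
  qed
  moreover have "\<exists>z < length s. s ! z = 0" using s unfolding ext_skolem_def by (elim conjE ex1E) blast
  ultimately show "skolem_pairs M s \<and> s ! 0 \<noteq> 0 \<and> s ! (2 * M) \<noteq> 0"
    using s by (auto simp: skolem_pairs_def ext_skolem_def)
next
  assume s: "skolem_pairs M s \<and> s ! 0 \<noteq> 0 \<and> s ! (2 * M) \<noteq> 0"
  have len: "length s = 2 * M + 1" using s by (simp add: skolem_pairs_def)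
  obtain z where "{l. l < length s \<and> s ! l = 0} = {z}" using s skolem_pairs_zero by blast
  then have "\<exists>!i. i < length s \<and> s ! i = 0" unfolding set_eq_iff by simp
  moreover have "\<exists>i j. i \<noteq> j \<and> {l. l < length s \<and> s ! l = k} = {i, j} \<and> \<bar>int i - int j\<bar> = k"
    if k: "k \<in> {1..int M}" for k
  proof -
    have "nat k \<in> {1..M}" using k by auto
    then obtain a where "{l. l < length s \<and> s ! l = int (nat k)} = {a, a + nat k}"
      using s skolem_pairs_positions by blast
    then show ?thesis using k by (intro exI[of _ a] exI[of _ "a + nat k"] conjI) simp_all
  qed
  ultimately show "ext_skolem M s" using s len by (simp add: ext_skolem_def)
qed

lemma skolem_pairs_rev:
  assumes "skolem_pairs M s"
  shows "skolem_pairs M (rev s)"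
proof -
  have len: "length s = 2 * M + 1" using assms by (simp add: skolem_pairs_def)
  have "\<exists>z < length s. rev s ! z = 0"
  proof -
    obtain z where "z < length s" "s ! z = 0" using assms by (auto simp: skolem_pairs_def)
    then show ?thesis by (intro exI[of _ "length s - Suc z"]) (auto simp: rev_nth)
  qed
  moreover have "\<exists>a. a + k < length s \<and> rev s ! a = int k \<and> rev s ! (a + k) = int k"
    if "k \<in> {1..M}" for k
  proof -
    obtain a where a: "a + k < length s" "s ! a = int k" "s ! (a + k) = int k"
      using skolem_pairs_obtain[OF assms \<open>k \<in> {1..M}\<close>] .
    have "length s - Suc (a + k) + k = length s - Suc a" using a(1) by simp
    then show ?thesis
      using a by (intro exI[of _ "length s - Suc (a + k)"]) (auto simp: rev_nth)
  qed
  ultimately show ?thesis using len by (simp add: skolem_pairs_def)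
qed

text \<open>Nest the odd symbols concentrically, then nest the even symbols around the hole.\<close>

lemma skolem_pairs_exists:
  assumes "q > 0"
  obtains t where "skolem_pairs q t" "rev t \<noteq> t"
proof -
  define b where "b = (q + 1) div 2"
  define e where "e = q div 2"
  have q: "q = b + e" "0 < b" using assms by (auto simp: b_def e_def)
  \<comment> \<open>The values are \<open>2b-1, ..., 3, 1, 1, 3, ..., 2b-1\<close> followed by
    \<open>2e, ..., 2, 0, 2, ..., 2e\<close>.\<close>
  define f :: "nat \<Rightarrow> int" where
    "f l = (if l < b then 2 * (int b - int l) - 1 else if l < 2 * b then 2 * (int l - int b) + 1
       else 2 * \<bar>int l - int (2 * b + e)\<bar>)" for l
  define t where "t = map f [0..<2 * q + 1]"
  have len: "length t = 2 * q + 1" by (simp add: t_def)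
  have nth: "t ! l = f l" if "l < 2 * q + 1" for l
    using that unfolding t_def by (simp del: upt_Suc)
  have "\<exists>a. a + k < length t \<and> t ! a = int k \<and> t ! (a + k) = int k" if k: "k \<in> {1..q}" for k
  proof (cases "even k")
    case True
    then obtain c where c: "k = 2 * c" by (elim evenE)
    then have "c \<le> e" "0 < c" using k by (auto simp: e_def)
    then show ?thesis using c q
      by (intro exI[of _ "2 * b + e - c"]) (auto simp: len nth f_def)
  next
    case False
    then obtain c where c: "k = 2 * c + 1" by (elim oddE)
    then have "c < b" using k by (auto simp: b_def)
    then show ?thesis using c q
      by (intro exI[of _ "b - 1 - c"]) (auto simp: len nth f_def)
  qed
  moreover have "\<exists>z < length t. t ! z = 0"
    using q by (intro exI[of _ "2 * b + e"]) (auto simp: len nth f_def)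
  ultimately have "skolem_pairs q t" using len by (simp add: skolem_pairs_def)
  moreover have "rev t \<noteq> t"
  proof
    assume "rev t = t"
    \<comment> \<open>The end entries \<open>2b-1\<close> and \<open>2e\<close> have different
      parity.\<close>
    then have "t ! 0 = t ! (2 * q)" using len rev_nth[of 0 t] by simp
    then have "2 * (int b) - 1 = 2 * int e" using q by (simp add: nth f_def)
    then show False by presburger
  qed
  ultimately show thesis by (rule that)
qed

section \<open>Permutations with prescribed displacements\<close>

text \<open>Domain and image have equal size, so each displacement occurs exactly once. Points are
  offsets inside a block, counted from 0.\<close>

definition spread_perms :: "nat \<Rightarrow> (nat \<Rightarrow> nat) set" where
  "spread_perms q = {g. g permutes {..<2 * q + 1} \<and>
     (\<lambda>r. int (g r) - int r) ` {..<2 * q + 1} = {- int q..int q}}"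

lemma finite_spread_perms: "finite (spread_perms q)"
  by (rule finite_subset[of _ "{g. g permutes {..<2 * q + 1}}"])
    (auto simp: spread_perms_def finite_permutations)

text \<open>Out-degree one makes the arc set the graph of a function, in-degree one makes it
  injective, and finiteness makes it onto.\<close>

lemma sum_digraphs_fun:
  assumes "S \<in> sum_digraphs n"
  obtains f where "parcs S = (\<lambda>i. (i, f i)) ` {1..n}" "bij_betw f {1..n} {1..n}"
proof -
  interpret pair_wf_digraph S using assms by (simp add: sum_digraphs_def)
  have v: "pverts S = {1..n}" using assms by (simp add: sum_digraphs_def)
  have out1: "card {e \<in> parcs S. fst e = i} = 1" and in1: "card {e \<in> parcs S. snd e = i} = 1"
    if "i \<in> {1..n}" for i
    using assms that v
    by (auto simp: sum_digraphs_def out_degree_def in_degree_def out_arcs_def in_arcs_def)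
  have sub: "parcs S \<subseteq> {1..n} \<times> {1..n}"
    using arc_fst_in_verts arc_snd_in_verts v by force
  define f where "f i = snd (the_elem {e \<in> parcs S. fst e = i})" for i
  have f: "(i, j) \<in> parcs S \<longleftrightarrow> j = f i" if i: "i \<in> {1..n}" for i j
  proof -
    obtain e where e: "{e \<in> parcs S. fst e = i} = {e}"
      using out1[OF i] by (auto simp: card_1_singleton_iff)
    then have mem: "e \<in> parcs S" "fst e = i" and unique: "\<And>x. x \<in> parcs S \<Longrightarrow> fst x = i \<Longrightarrow> x = e"
      by blast+
    have "f i = snd e" using e by (simp add: f_def)
    with mem unique[of "(i, j)"] show ?thesis by (cases e) auto
  qed
  have parcs: "parcs S = (\<lambda>i. (i, f i)) ` {1..n}"
    using f sub by (auto simp: image_iff)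
  have "inj_on f {1..n}"
  proof (rule inj_onI)
    fix i j assume ij: "i \<in> {1..n}" "j \<in> {1..n}" "f i = f j"
    then have "(i, f i) \<in> parcs S" "(j, f i) \<in> parcs S" by (simp_all add: f)
    moreover from this sub have "f i \<in> {1..n}" by auto
    then obtain e where "{e \<in> parcs S. snd e = f i} = {e}"
      using in1 by (metis card_1_singletonE)
    then have "x = e" if "x \<in> parcs S" "snd x = f i" for x using that by blast
    ultimately have "(i, f i) = (j, f i)" by (metis snd_conv)
    then show "i = j" by simp
  qed
  moreover have "f ` {1..n} \<subseteq> {1..n}" using parcs sub by auto
  ultimately have "bij_betw f {1..n} {1..n}" by (intro bij_betw_imageI endo_inj_surj) simp_all
  with parcs that show thesis by blast
qed

lemma sum_digraphs_perm:
  assumes S: "S \<in> sum_digraphs (2 * q + 1)"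
  obtains g where "g \<in> spread_perms q"
    "parcs S = (\<lambda>r. (r + 1, 2 * q + 1 - g r)) ` {..<2 * q + 1}"
proof -
  define n where "n = 2 * q + 1"
  obtain f where f: "parcs S = (\<lambda>i. (i, f i)) ` {1..n}" "bij_betw f {1..n} {1..n}"
    using sum_digraphs_fun[OF S] unfolding n_def by blast
  obtain a where a: "(\<lambda>(i, j). i + j) ` parcs S = {a..<a + n}"
    using S by (auto simp: sum_digraphs_def n_def)
  have im: "(\<lambda>i. i + f i) ` {1..n} = {a..<a + n}"
    using a by (simp add: f(1) image_image)
  then have inj: "inj_on (\<lambda>i. i + f i) {1..n}" by (intro eq_card_imp_inj_on) auto
  have a: "a = q + 2"
  proof -
    have "\<Sum>{a..<a + n} = (\<Sum>i\<in>{1..n}. i + f i)"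
      using sum.reindex[OF inj, of id] im by simp
    also have "\<dots> = (\<Sum>i\<in>{1..n}. i) + (\<Sum>i\<in>{1..n}. f i)" by (rule sum.distrib)
    also have "(\<Sum>i\<in>{1..n}. f i) = (\<Sum>i\<in>{1..n}. i)" by (rule sum.reindex_bij_betw[OF f(2)])
    also have "(\<Sum>i\<in>{1..n}. i) + (\<Sum>i\<in>{1..n}. i) = n * (n + 1)"
      by (induction n) auto
    finally have 1: "\<Sum>{a..<a + n} = n * (n + 1)" .
    \<comment> \<open>The arithmetic series, doubled and free of subtraction so that it stays in the
      naturals.\<close>
    have "2 * \<Sum>{a..<a + k} + k = 2 * k * a + k * k" for k
      by (induction k) (auto simp: algebra_simps)
    from this[of n] 1 have "n * (2 * (n + 1) + 1) = n * (2 * a + n)" by (simp add: algebra_simps)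
    moreover have "n > 0" by (simp add: n_def)
    ultimately have "2 * (n + 1) + 1 = 2 * a + n" by (metis nat_mult_eq_cancel1)
    then show ?thesis by (simp add: n_def)
  qed
  have fr: "f i \<in> {1..n}" if "i \<in> {1..n}" for i using f(2) that by (auto simp: bij_betw_def)
  \<comment> \<open>Offset \<open>r\<close> stands for vertex \<open>r + 1\<close>. The displacement
    of \<open>g\<close> at \<open>r\<close> is then \<open>n + 1\<close> minus the arc sum, and the
    arc sums fill \<open>q + 2, ..., 3q + 2\<close>.\<close>
  define g where "g r = (if r < n then n - f (r + 1) else r)" for r
  have fg: "f (r + 1) = n - g r" "g r < n" if "r < n" for r
    using fr[of "r + 1"] that by (auto simp: g_def)
  have shift: "{1..n} = (\<lambda>r. r + 1) ` {..<n}"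
    by (simp add: lessThan_atLeast0 image_Suc_atLeastLessThan atLeastLessThanSuc_atLeastAtMost)
  have "inj_on g {..<n}"
  proof (rule inj_onI)
    fix r r' assume r: "r \<in> {..<n}" "r' \<in> {..<n}" "g r = g r'"
    then have "f (r + 1) = f (r' + 1)" using fg by simp
    moreover have "inj_on f {1..n}" using f(2) by (rule bij_betw_imp_inj_on)
    moreover have "r + 1 \<in> {1..n}" "r' + 1 \<in> {1..n}" using r by simp_all
    ultimately have "r + 1 = r' + 1" by (meson inj_onD)
    then show "r = r'" by simp
  qed
  moreover have "g ` {..<n} \<subseteq> {..<n}" using fg by auto
  ultimately have "bij_betw g {..<n} {..<n}" by (intro bij_betw_imageI endo_inj_surj) simp_all
  then have perm: "g permutes {..<n}" by (rule bij_imp_permutes) (simp add: g_def)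
  have "(\<lambda>r. int (g r) - int r) ` {..<n} = (\<lambda>r. int (n + 1) - int ((r + 1) + f (r + 1))) ` {..<n}"
  proof (intro image_cong refl)
    fix r assume "r \<in> {..<n}"
    then have "int (f (r + 1)) = int n - int (g r)" using fg[of r] by (simp add: of_nat_diff)
    then show "int (g r) - int r = int (n + 1) - int ((r + 1) + f (r + 1))" by simp
  qed
  also have "\<dots> = (\<lambda>x. int (n + 1) - int x) ` {a..<a + n}"
    unfolding im[symmetric] shift image_image ..
  also have "\<dots> = {- int q..int q}"
  proof (intro set_eqI iffI)
    fix x assume x: "x \<in> {- int q..int q}"
    then have y: "int (nat (int (n + 1) - x)) = int (n + 1) - x" by (simp add: n_def)
    with x have "nat (int (n + 1) - x) \<in> {a..<a + n}"
      unfolding atLeastLessThan_iff atLeastAtMost_iff a n_def by (intro conjI; linarith)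
    with y show "x \<in> (\<lambda>x. int (n + 1) - int x) ` {a..<a + n}"
      by (intro image_eqI[of _ _ "nat (int (n + 1) - x)"]) simp_all
  qed (auto simp: a n_def)
  finally have "g \<in> spread_perms q" using perm by (simp add: spread_perms_def n_def)
  moreover have "parcs S = (\<lambda>r. (r + 1, 2 * q + 1 - g r)) ` {..<2 * q + 1}"
    unfolding f(1) shift image_image n_def[symmetric] using fg by (intro image_cong) auto
  ultimately show thesis by (rule that)
qed

text \<open>\<open>D\<close> rebuilds a digraph from its permutation, so its image covers all
  digraphs; a lower bound on \<open>eps\<close> needs just this direction.\<close>

lemma card_sum_digraphs_le: "card (sum_digraphs (2 * q + 1)) \<le> card (spread_perms q)"
proof -
  define D :: "(nat \<Rightarrow> nat) \<Rightarrow> nat pair_pre_digraph" where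
    "D g = \<lparr>pverts = {1..2 * q + 1},
       parcs = (\<lambda>r. (r + 1, 2 * q + 1 - g r)) ` {..<2 * q + 1}\<rparr>" for g
  have "sum_digraphs (2 * q + 1) \<subseteq> D ` spread_perms q"
  proof
    fix S assume S: "S \<in> sum_digraphs (2 * q + 1)"
    obtain g where "g \<in> spread_perms q"
      "parcs S = (\<lambda>r. (r + 1, 2 * q + 1 - g r)) ` {..<2 * q + 1}"
      using sum_digraphs_perm[OF S] .
    moreover have "pverts S = {1..2 * q + 1}" using S by (simp add: sum_digraphs_def)
    ultimately show "S \<in> D ` spread_perms q" unfolding D_def
      by (intro image_eqI[of _ _ g]) auto
  qed
  then show ?thesis by (rule surj_card_le[OF finite_spread_perms])
qed

section \<open>Inflating a sequence\<close>

text \<open>The first occurrence of a symbol \<open>k\<close> is recognised by a second one \<open>k\<close> places further on.\<close>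

definition inflate_entry ::
  "nat \<Rightarrow> (nat \<Rightarrow> nat \<Rightarrow> nat) \<Rightarrow> int list \<Rightarrow> int list \<Rightarrow> nat \<Rightarrow> nat \<Rightarrow> int" where
  "inflate_entry n g t s p r =
     (let k = s ! p in
      if k = 0 then t ! r
      else if p + nat k < length s \<and> s ! (p + nat k) = k
        then int n * k + (int (g (nat k) r) - int r)
        else int n * k + (int r - int (inv (g (nat k)) r)))"

definition inflate ::
  "nat \<Rightarrow> (nat \<Rightarrow> nat \<Rightarrow> nat) \<Rightarrow> int list \<Rightarrow> int list \<Rightarrow> int list" where
  "inflate n g t s = map (\<lambda>l. inflate_entry n g t s (l div n) (l mod n)) [0..<n * length s]"

lemma length_inflate [simp]: "length (inflate n g t s) = n * length s"
  by (simp add: inflate_def)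

lemma block_index_less:
  fixes n p r l :: nat
  assumes "r < n" "p < l"
  shows "n * p + r < n * l"
proof -
  have "n * p + r < n * (p + 1)" using assms(1) by simp
  also have "\<dots> \<le> n * l" using assms(2) by (intro mult_le_mono2) simp
  finally show ?thesis .
qed

lemma nth_inflate:
  assumes "r < n" "p < length s"
  shows "inflate n g t s ! (n * p + r) = inflate_entry n g t s p r"
proof -
  have "(n * p + r) div n = p" "(n * p + r) mod n = r" using assms(1) by simp_all
  then show ?thesis using block_index_less[OF assms] by (simp add: inflate_def)
qed

section \<open>Entries of an inflated sequence\<close>

context
  fixes q m n :: nat and g :: "nat \<Rightarrow> nat \<Rightarrow> nat" and t s :: "int list"
  assumes n: "n = 2 * q + 1"
    and g: "g \<in> {1..m} \<rightarrow>\<^sub>E spread_perms q"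
    and t: "skolem_pairs q t"
    and s: "skolem_pairs m s"
begin

lemma spread_perms_nth:
  assumes "k \<in> {1..m}"
  shows "g k permutes {..<n}" "(\<lambda>r. int (g k r) - int r) ` {..<n} = {- int q..int q}"
  using PiE_mem[OF g assms] by (auto simp: spread_perms_def n)

text \<open>Each entry differs from \<open>n\<close> times its symbol by at most \<open>q\<close>,
  and \<open>n = 2 * q + 1\<close>; adding \<open>q\<close> before dividing therefore rounds to the
  nearest multiple.\<close>

lemma inflate_decode:
  assumes r: "r < n" and p: "p < length s"
  shows "(inflate n g t s ! (n * p + r) + int q) div int n = s ! p"
proof (cases "s ! p = 0")
  case True
  have "t ! r \<in> {0..int q}"
    using t r n by (intro skolem_pairs_count(2)) (auto simp: skolem_pairs_def)
  then have "(t ! r + int q) div int n = 0" by (simp add: n)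
  with True show ?thesis by (simp add: nth_inflate[OF r p] inflate_entry_def)
next
  case False
  define k where "k = nat (s ! p)"
  have k: "s ! p = int k" "k \<in> {1..m}"
    using skolem_pairs_count(2)[OF s p] False by (auto simp: k_def)
  note perm = spread_perms_nth[OF k(2)]
  have d: "int (g k x) - int x \<in> {- int q..int q}" if "x < n" for x
    unfolding perm(2)[symmetric] using that by (intro imageI) simp
  \<comment> \<open>An offset in a second block carries the displacement of \<open>g k\<close> at
    its preimage, so the same bound applies.\<close>
  have "inv (g k) r < n" "g k (inv (g k) r) = r"
    using permutes_in_image[OF permutes_inv[OF perm(1)], of r] r permutes_inverses(1)[OF perm(1)]
    by auto
  with d[of "inv (g k) r"]
  have d': "int r - int (inv (g k) r) \<in> {- int q..int q}" by simp
  define d where "d = (if p + k < length s \<and> s ! (p + k) = int k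
    then int (g k r) - int r else int r - int (inv (g k) r))"
  have "inflate n g t s ! (n * p + r) = int n * int k + d"
    using False k(1) unfolding nth_inflate[OF r p] inflate_entry_def d_def by (simp add: Let_def)
  moreover have "d \<in> {- int q..int q}" using d[OF r] d' by (simp add: d_def)
  ultimately have d: "inflate n g t s ! (n * p + r) = int n * int k + d" "d \<in> {- int q..int q}" .
  have "((d + int q) + int n * int k) div int n = int k + (d + int q) div int n"
    by (rule div_mult_self2) (simp add: n)
  also have "(d + int q) div int n = 0" using d(2) by (simp add: n)
  finally show ?thesis using d k by (simp add: algebra_simps)
qed

lemma inflate_first:
  assumes "k \<in> {1..m}" "{l. l < length s \<and> s ! l = int k} = {a, a + k}" "r < n"
  shows "inflate n g t s ! (n * a + r) = int n * int k + (int (g k r) - int r)"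
proof -
  have "a + k < length s" "s ! a = int k" "s ! (a + k) = int k" using assms(2) by auto
  then show ?thesis
    using assms(1,3) nth_inflate[of r n a s g t] by (simp add: inflate_entry_def)
qed

text \<open>The partner of offset \<open>r\<close> in the first block is offset \<open>g k r\<close>
  in the second. The inverse recovers \<open>r\<close>, so both carry the same value, which is also
  their distance.\<close>

lemma inflate_second:
  assumes k: "k \<in> {1..m}" and a: "{l. l < length s \<and> s ! l = int k} = {a, a + k}" and r: "r < n"
  shows "inflate n g t s ! (n * (a + k) + g k r) = int n * int k + (int (g k r) - int r)"
proof -
  note perm = spread_perms_nth[OF k]
  have mem: "a + k < length s" "s ! (a + k) = int k" using a by auto
  \<comment> \<open>With no third occurrence of \<open>k\<close>, \<open>inflate_entry\<close> takes
    its second branch here.\<close>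
  have "a + k + k \<notin> {l. l < length s \<and> s ! l = int k}" using k unfolding a by auto
  moreover have "g k r < n" using permutes_in_image[OF perm(1), of r] r by auto
  ultimately show ?thesis
    using k mem nth_inflate[of "g k r" n "a + k" s g t]
    by (auto simp: inflate_entry_def permutes_inverses(2)[OF perm(1)])
qed

lemma inflate_zero:
  assumes "z < length s" "s ! z = 0" "r < n"
  shows "inflate n g t s ! (n * z + r) = t ! r"
  using assms by (simp add: nth_inflate inflate_entry_def)

text \<open>Values up to \<open>q\<close> come from \<open>t\<close> in the block of
  \<open>0\<close>. The intervals from \<open>n * k - q\<close> to \<open>n * k + q\<close>, for
  \<open>k\<close> from 1 to \<open>m\<close>, tile the rest.\<close>

lemma skolem_pairs_inflate: "skolem_pairs (m * n + q) (inflate n g t s)"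
proof -
  let ?s = "inflate n g t s"
  have len: "length s = 2 * m + 1" "length t = n"
    using s t by (auto simp: skolem_pairs_def n)
  obtain z where z: "z < length s" "s ! z = 0" using s by (auto simp: skolem_pairs_def)
  have "\<exists>z < length ?s. ?s ! z = 0"
  proof -
    obtain y where y: "y < n" "t ! y = 0" using t len by (auto simp: skolem_pairs_def)
    show ?thesis
      using inflate_zero[OF z y(1)] y block_index_less[OF y(1) z(1)]
      by (intro exI[of _ "n * z + y"]) simp
  qed
  moreover have "\<exists>a. a + v < length ?s \<and> ?s ! a = int v \<and> ?s ! (a + v) = int v"
    if v: "v \<in> {1..m * n + q}" for v
  proof (cases "v \<le> q")
    case True
    then have "v \<in> {1..q}" using v by simp
    then obtain a where a: "a + v < n" "t ! a = int v" "t ! (a + v) = int v"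
      using skolem_pairs_obtain[OF t] len by metis
    then show ?thesis
      using inflate_zero[OF z, of a] inflate_zero[OF z, of "a + v"] block_index_less[OF a(1) z(1)]
      by (intro exI[of _ "n * z + a"]) (simp add: add.assoc)
  next
    case False
    \<comment> \<open>Here \<open>k\<close> is \<open>v / n\<close> rounded to the nearest integer,
      which leaves a remainder \<open>d\<close> between \<open>-q\<close> and
      \<open>q\<close>.\<close>
    define k where "k = (v + q) div n"
    define d where "d = int v - int n * int k"
    have "n * k + (v + q) mod n = v + q" unfolding k_def by (rule mult_div_mod_eq)
    moreover have "(v + q) mod n < n" by (rule mod_less_divisor) (simp add: n)
    ultimately obtain x where x: "n * k + x = v + q" "x < n" by blast
    have d: "d \<in> {- int q..int q}"
    proof -
      have "int n * int k + int x = int v + int q" using x(1) by (metis of_nat_add of_nat_mult)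
      then show ?thesis using x(2) by (auto simp: d_def n)
    qed
    have k: "k \<in> {1..m}"
    proof -
      have "n \<le> v + q" "0 < n" using False by (simp_all add: n)
      then have "1 \<le> k" unfolding k_def by (simp add: div_greater_zero_iff Suc_le_eq)
      moreover have "v + q < (m + 1) * n" using v n by simp
      then have "k < m + 1" unfolding k_def by (rule less_mult_imp_div_less)
      ultimately show ?thesis by simp
    qed
    obtain r where r: "r < n" "int (g k r) - int r = d"
      using d unfolding spread_perms_nth(2)[OF k, symmetric] by blast
    obtain a where a: "{l. l < length s \<and> s ! l = int k} = {a, a + k}"
      using skolem_pairs_positions[OF s k] .
    have gr: "g k r < n" using permutes_in_image[OF spread_perms_nth(1)[OF k], of r] r by auto
    have "int (n * a + r + v) = int (n * (a + k) + g k r)"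
      using r(2) by (simp add: d_def algebra_simps)
    then have pos: "n * a + r + v = n * (a + k) + g k r" by (rule of_nat_eq_iff[THEN iffD1])
    have ak: "a + k < length s" using a by auto
    show ?thesis
      using inflate_first[OF k a r(1)] inflate_second[OF k a r(1)] r(2)
        block_index_less[OF gr ak]
      by (intro exI[of _ "n * a + r"]) (simp only: pos length_inflate, simp add: d_def)
  qed
  moreover have "length ?s = 2 * (m * n + q) + 1" using len by (simp add: n algebra_simps)
  ultimately show ?thesis by (simp add: skolem_pairs_def)
qed

end

text \<open>An entry \<open>0\<close> decodes to the symbol \<open>0\<close>, but the first and last
  blocks belong to nonzero symbols.\<close>

lemma ext_skolem_inflate:
  assumes n: "n = 2 * q + 1"
    and 1: "g \<in> {1..m} \<rightarrow>\<^sub>E spread_perms q" "skolem_pairs q t" "ext_skolem m s"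
  shows "ext_skolem (m * n + q) (inflate n g t s)"
proof -
  have s: "skolem_pairs m s" "s ! 0 \<noteq> 0" "s ! (2 * m) \<noteq> 0" "length s = 2 * m + 1"
    using 1(3) by (auto simp: ext_skolem_iff skolem_pairs_def)
  have q: "int q div int n = 0" "2 * q < n" "0 < n" by (simp_all add: n)
  note decode = inflate_decode[OF n 1(1,2) s(1)]
  have "inflate n g t s ! 0 \<noteq> 0"
    using decode[OF q(3), of 0] s q(1) by auto
  moreover have "inflate n g t s ! (n * (2 * m) + 2 * q) \<noteq> 0"
    using decode[OF q(2), of "2 * m"] s q(1) by auto
  moreover have "n * (2 * m) + 2 * q = 2 * (m * n + q)" by (simp add: algebra_simps)
  ultimately show ?thesis
    using skolem_pairs_inflate[OF n 1(1,2) s(1)] by (simp add: ext_skolem_iff)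
qed

text \<open>Decoding offset 0 of every block gives \<open>s\<close>. With the blocks known, the
  block of \<open>0\<close> shows \<open>t\<close>, and the first block of \<open>k\<close> shows
  the displacements of \<open>g k\<close>.\<close>

lemma inflate_inject:
  assumes n: "n = 2 * q + 1"
    and 1: "g \<in> {1..m} \<rightarrow>\<^sub>E spread_perms q" "skolem_pairs q t" "skolem_pairs m s"
    and 2: "g' \<in> {1..m} \<rightarrow>\<^sub>E spread_perms q" "skolem_pairs q t'" "skolem_pairs m s'"
    and eq: "inflate n g t s = inflate n g' t' s'"
  shows "g = g' \<and> t = t' \<and> s = s'"
proof -
  have len: "length s = 2 * m + 1" "length s' = 2 * m + 1" "length t = n" "length t' = n"
    using n 1 2 by (simp_all add: skolem_pairs_def)
  have ss: "s = s'"
  proof (rule nth_equalityI)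
    fix p assume "p < length s"
    then show "s ! p = s' ! p"
      using n inflate_decode[OF n 1, of 0 p] inflate_decode[OF n 2, of 0 p] len eq by simp
  qed (simp add: len)
  obtain z where z: "z < length s" "s ! z = 0" using 1 by (auto simp: skolem_pairs_def)
  have "t = t'"
  proof (rule nth_equalityI)
    fix r assume "r < length t"
    then show "t ! r = t' ! r"
      using inflate_zero[OF n 1 z, of r] inflate_zero[OF n 2, of z r] z ss len eq by simp
  qed (simp add: len)
  moreover have "g = g'"
  proof (rule PiE_ext[OF 1(1) 2(1)])
    fix k assume k: "k \<in> {1..m}"
    obtain a where a: "{l. l < length s \<and> s ! l = int k} = {a, a + k}"
      using skolem_pairs_positions[OF 1(3) k] .
    show "g k = g' k"
    proof
      fix r
      show "g k r = g' k r"
      proof (cases "r < n")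
        case True
        then show ?thesis
          using inflate_first[OF n 1 k a True] inflate_first[OF n 2 k a[unfolded ss] True] eq by simp
      next
        case False
        then show ?thesis
          using permutes_not_in[OF spread_perms_nth(1)[OF n 1 k], of r] permutes_not_in[OF spread_perms_nth(1)[OF n 2 k], of r]
          by simp
      qed
    qed
  qed
  ultimately show ?thesis using ss by simp
qed

section \<open>Counting the choices\<close>

theorem theorem4p4:
  fixes m n :: nat
  assumes "0 < m" and "0 < n" and "odd n" and "n \<noteq> 1"
  shows "eps (m * n + (n - 1) div 2) \<ge> 2 * card (sum_digraphs n) ^ m * eps m"
proof -
  obtain q where n: "n = 2 * q + 1" using \<open>odd n\<close> oddE by blast
  \<comment> \<open>For \<open>q = 0\<close> the only filling is \<open>[0]\<close>, its own
    reversal, and the factor 2 would be lost.\<close>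
  then have q: "q > 0" "(n - 1) div 2 = q" using \<open>n \<noteq> 1\<close> by auto
  obtain t where t: "skolem_pairs q t" "rev t \<noteq> t" using skolem_pairs_exists[OF q(1)] .
  \<comment> \<open>Extensional functions make the choices of \<open>g\<close> a finite power;
    \<open>{t, rev t}\<close> supplies the factor 2.\<close>
  let ?X = "({1..m} \<rightarrow>\<^sub>E spread_perms q) \<times> {t, rev t} \<times> {s. ext_skolem m s}"
  let ?F = "\<lambda>(g, t, s). inflate n g t s"
  have T: "skolem_pairs q u" if "u \<in> {t, rev t}" for u using that t(1) skolem_pairs_rev by auto
  have "inj_on ?F ?X"
  proof (rule inj_onI)
    fix x y assume xy: "x \<in> ?X" "y \<in> ?X" "?F x = ?F y"
    obtain g u s where x: "x = (g, u, s)" by (rule prod_cases3)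
    obtain g' u' s' where y: "y = (g', u', s')" by (rule prod_cases3)
    have "g = g' \<and> u = u' \<and> s = s'"
      by (rule inflate_inject[OF n, of g m u s g' u' s'])
        (use xy T in \<open>simp_all add: x y ext_skolem_iff\<close>)
    then show "x = y" by (simp add: x y)
  qed
  moreover have "?F ` ?X \<subseteq> {s. ext_skolem (m * n + (n - 1) div 2) s}"
    unfolding q(2) using ext_skolem_inflate[OF n] T by auto
  ultimately have "card ?X \<le> eps (m * n + (n - 1) div 2)"
    unfolding eps_def by (rule card_inj_on_le[OF _ _ finite_ext_skolem])
  moreover have "card ?X = card (spread_perms q) ^ m * (2 * eps m)"
    using t(2) by (auto simp: card_cartesian_product card_PiE eps_def)
  moreover have "card (sum_digraphs n) ^ m * (2 * eps m) \<le> card (spread_perms q) ^ m * (2 * eps m)"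
    unfolding n by (intro mult_le_mono1 power_mono card_sum_digraphs_le) simp
  ultimately have "card (sum_digraphs n) ^ m * (2 * eps m) \<le> eps (m * n + (n - 1) div 2)"
    by linarith
  then show ?thesis by (simp only: ac_simps)
qed

end
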